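(* There exists an odd unimodular lattice in dimension $41$ (that is, in $\mathbb{R}^{41}$) having minimum norm $4$.
   Context: A (Euclidean) lattice $L$ in dimension $n$ is a full-rank lattice in $\mathbb{R}^n$ with the standard inner product $(x,y)$. It is unimodular if $L=L^*$, where $L^*=\{x\in\mathbb{R}^n \mid (x,y)\in\mathbb{Z} \text{ for all } y\in L\}$ is the dual lattice. The norm of a vector $x$ is $(x,x)$ (not its square root), and the minimum norm of $L$ is the smallest norm among all nonzero vectors of $L$. A unimodular lattice is even if all its vectors have even norm, and odd otherwise. *)

theory Defs
  imports "HOL-Analysis.Analysis"
begin

text \<open>
  Full-rank lattices: the integer combinations of a basis of the ambient Euclidean space.
  (An independent set in a Euclidean space is finite, so the sum below is a genuine one.)
\<close>

definition euclidean_lattice :: "'a::euclidean_space set \<Rightarrow> bool" where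
  "euclidean_lattice L \<longleftrightarrow>
    (\<exists>B. independent B \<and> span B = UNIV \<and>
         L = {(\<Sum>b\<in>B. real_of_int (c b) *\<^sub>R b) | c :: 'a \<Rightarrow> int. True})"

definition dual_lattice :: "'a::euclidean_space set \<Rightarrow> 'a set" where
  "dual_lattice L = {x. \<forall>y\<in>L. x \<bullet> y \<in> \<int>}"

definition unimodular_lattice :: "'a::euclidean_space set \<Rightarrow> bool" where
  "unimodular_lattice L \<longleftrightarrow> euclidean_lattice L \<and> L = dual_lattice L"

text \<open>
  The norm of a lattice vector \<open>x\<close> is the squared length \<open>x \<bullet> x\<close>, not \<^term>\<open>norm x\<close>.
\<close>

definition even_unimodular_lattice :: "'a::euclidean_space set \<Rightarrow> bool" where
  "even_unimodular_lattice L \<longleftrightarrow>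
    unimodular_lattice L \<and> (\<forall>x\<in>L. \<exists>k::int. even k \<and> x \<bullet> x = real_of_int k)"

definition odd_unimodular_lattice :: "'a::euclidean_space set \<Rightarrow> bool" where
  "odd_unimodular_lattice L \<longleftrightarrow> unimodular_lattice L \<and> \<not> even_unimodular_lattice L"

text \<open>A relation rather than a function, so that the minimum is required to be attained.\<close>

definition has_minimum_norm :: "'a::euclidean_space set \<Rightarrow> real \<Rightarrow> bool" where
  "has_minimum_norm L m \<longleftrightarrow>
    (\<exists>x\<in>L. x \<noteq> 0 \<and> x \<bullet> x = m) \<and> (\<forall>x\<in>L. x \<noteq> 0 \<longrightarrow> m \<le> x \<bullet> x)"

end

theory Submission
  imports Defs
begin

text \<open>
  Let \<open>C\<close> be a doubly-even binary code of length 41 with minimum weight 16 and dual distance at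
  least 4. Lift a basis of \<open>C\<close> to integer vectors \<open>g i\<close> whose inner products are divisible by 4, and
  let \<open>L\<close> consist of the halves of the vectors \<open>\<Sum>i. c i * g i + 2 * z\<close> where \<open>z\<close> reduces to the dual
  of \<open>C\<close> modulo 2 (Construction A for a self-dual code over the integers modulo 4). Self-duality of
  the code makes \<open>L\<close> unimodular. A vector of \<open>L\<close> with some \<open>c i\<close> odd is half of a vector with at
  least 16 odd entries, so its norm is at least 4; any other vector of \<open>L\<close> is an integer vector
  reducing to the dual of \<open>C\<close>, so either it is divisible by 2 or it has at least 4 odd entries.
  A word of odd weight in the dual of \<open>C\<close> gives a vector of odd norm.
\<close>

section \<open>Bases of discrete subgroups of a Euclidean space\<close>

lemma subgroup_int_scale:
  fixes M :: "'a::real_vector set"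
  assumes "0 \<in> M" and diff: "\<And>x y. x \<in> M \<Longrightarrow> y \<in> M \<Longrightarrow> x - y \<in> M" and x: "x \<in> M"
  shows "real_of_int k *\<^sub>R x \<in> M"
proof (induction k rule: int_induct[where k = 0])
  case base
  then show ?case using assms(1) by simp
next
  case (step1 i)
  have "- x \<in> M" using diff[OF assms(1) x] by simp
  from diff[OF step1(2) this] show ?case by (simp add: algebra_simps)
next
  case (step2 i)
  from diff[OF step2(2) x] show ?case by (simp add: algebra_simps)
qed

lemma subgroup_int_combination:
  fixes M :: "'a::real_vector set"
  assumes "0 \<in> M" and diff: "\<And>x y. x \<in> M \<Longrightarrow> y \<in> M \<Longrightarrow> x - y \<in> M" and "finite B" "B \<subseteq> M"
  shows "(\<Sum>b\<in>B. real_of_int (c b) *\<^sub>R b) \<in> M"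
  using assms(3,4)
proof (induction B rule: finite_induct)
  case empty
  then show ?case using assms(1) by simp
next
  case (insert b B)
  have "(\<Sum>b\<in>B. real_of_int (c b) *\<^sub>R b) - real_of_int (- c b) *\<^sub>R b \<in> M"
    using insert subgroup_int_scale[OF assms(1) diff, where x=b and k="- c b"] by (intro diff) auto
  then show ?case using insert by (simp add: algebra_simps)
qed

text \<open>This is Hermite reduction, one coordinate at a time: \<open>S\<close> holds the
  coordinates in which \<open>M\<close> may be nonzero. An element of \<open>M\<close> whose
  \<open>s\<close>-coordinate is nonzero and smallest in absolute value clears that coordinate from
  all others by Euclidean division, and what is left lives on fewer coordinates.\<close>

lemma discrete_subgroup_has_basis:
  fixes M :: "'a::euclidean_space set" and r :: real
  assumes "finite S" "0 \<in> M" "\<And>x y. x \<in> M \<Longrightarrow> y \<in> M \<Longrightarrow> x - y \<in> M"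
    and "r \<noteq> 0" "\<And>x b. x \<in> M \<Longrightarrow> b \<in> Basis \<Longrightarrow> r * (x \<bullet> b) \<in> \<int>"
    and "S \<subseteq> Basis" "\<And>x b. x \<in> M \<Longrightarrow> b \<in> Basis - S \<Longrightarrow> x \<bullet> b = 0"
  shows "\<exists>B. independent B \<and> M = {(\<Sum>b\<in>B. real_of_int (c b) *\<^sub>R b) | c :: 'a \<Rightarrow> int. True}"
  using assms
proof (induction S arbitrary: M rule: finite_induct)
  case empty
  then have "x = 0" if "x \<in> M" for x
    using that by (auto intro: euclidean_eqI)
  with empty(1) have "M = {0}" by blast
  then show ?case by (intro exI[of _ "{}"]) (auto simp: independent_empty)
next
  case (insert s S)
  note zero = insert.prems(1) and diff = insert.prems(2) and ints = insert.prems(4)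
  have s: "s \<in> Basis" using insert by auto
  have orth: "x \<bullet> b = 0" if "x \<in> M" "x \<bullet> s = 0" "b \<in> Basis" "b \<notin> S" for x b
    using insert.prems(6)[OF that(1), of b] that by (cases "b = s") auto
  show ?case
  proof (cases "\<forall>x\<in>M. x \<bullet> s = 0")
    case True
    then show ?thesis
      by (intro insert.IH) (use insert.prems orth in auto)
  next
    case False
    \<comment> \<open>On \<open>M\<close> the scaled coordinate is an integer, so the floor is exact
      there and only changes the type.\<close>
    define h where "h x = \<lfloor>r * (x \<bullet> s)\<rfloor>" for x
    have h: "real_of_int (h x) = r * (x \<bullet> s)" if "x \<in> M" for x
      using ints[OF that s] unfolding h_def by (metis Ints_cases floor_of_int)
    have h0: "h x = 0 \<longleftrightarrow> x \<bullet> s = 0" if "x \<in> M" for x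
      using h[OF that] \<open>r \<noteq> 0\<close> by (metis mult_eq_0_iff of_int_eq_0_iff)
    obtain b where b: "b \<in> M" "h b \<noteq> 0"
      and b_min: "\<And>x. x \<in> M \<Longrightarrow> h x \<noteq> 0 \<Longrightarrow> nat \<bar>h b\<bar> \<le> nat \<bar>h x\<bar>"
      using False h0 ex_has_least_nat[of "\<lambda>x. x \<in> M \<and> h x \<noteq> 0" _ "\<lambda>x. nat \<bar>h x\<bar>"] by blast
    define q where "q x = h x div h b" for x
    have red_M: "x - real_of_int (q x) *\<^sub>R b \<in> M" if "x \<in> M" for x
      using that b(1) by (intro diff subgroup_int_scale zero)
    have red_s: "(x - real_of_int (q x) *\<^sub>R b) \<bullet> s = 0" if "x \<in> M" for x
    proof -
      let ?x = "x - real_of_int (q x) *\<^sub>R b"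
      have "real_of_int (h ?x) = real_of_int (h x - q x * h b)"
        using h[OF red_M[OF that]] h[OF that] h[OF b(1)] by (simp add: algebra_simps)
      then have "h ?x = h x mod h b"
        unfolding q_def of_int_eq_iff by (simp add: minus_div_mult_eq_mod)
      then have "\<bar>h ?x\<bar> < \<bar>h b\<bar>"
        using b(2) by (simp add: abs_mod_less)
      then show ?thesis
        using b_min[OF red_M[OF that]] h0[OF red_M[OF that]] by linarith
    qed
    define M' where "M' = {x \<in> M. x \<bullet> s = 0}"
    have "\<exists>B. independent B \<and> M' = {(\<Sum>b\<in>B. real_of_int (c b) *\<^sub>R b) | c :: 'a \<Rightarrow> int. True}"
      by (rule insert.IH) (use insert.prems orth in \<open>auto simp: M'_def inner_diff_left\<close>)
    then obtain B where B: "independent B"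
      and M': "M' = {(\<Sum>b\<in>B. real_of_int (c b) *\<^sub>R b) | c :: 'a \<Rightarrow> int. True}"
      by blast
    have fin: "finite B" using B independent_bound_general by blast
    have "B \<subseteq> M'"
    proof
      fix x assume "x \<in> B"
      have "(\<Sum>b\<in>B. real_of_int (if b = x then 1 else 0) *\<^sub>R b) = (\<Sum>b\<in>B. if b = x then b else 0)"
        by (intro sum.cong) auto
      also have "\<dots> = x" using fin \<open>x \<in> B\<close> by simp
      finally have "x = (\<Sum>b\<in>B. real_of_int (if b = x then 1 else 0) *\<^sub>R b)" ..
      then show "x \<in> M'" unfolding M' by (intro CollectI exI[of _ "\<lambda>b. if b = x then 1 else 0"]) simp
    qed
    \<comment> \<open>The new vector \<open>b\<close> leaves the hyperplane that contains all of
      \<open>B\<close>, which gives independence of \<open>insert b B\<close>.\<close>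
    have "span B \<subseteq> {x. x \<bullet> s = 0}"
      using \<open>B \<subseteq> M'\<close> by (intro span_minimal) (auto simp: M'_def subspace_def inner_add_left)
    then have b_span: "b \<notin> span B" using h0 b by blast
    then have "b \<notin> B" using span_base by blast
    have "M = {(\<Sum>b\<in>insert b B. real_of_int (c b) *\<^sub>R b) | c :: 'a \<Rightarrow> int. True}"
    proof (intro equalityI subsetI)
      fix x assume x: "x \<in> M"
      then have "x - real_of_int (q x) *\<^sub>R b \<in> M'"
        using red_M red_s by (simp add: M'_def)
      then obtain c :: "'a \<Rightarrow> int"
        where c: "x - real_of_int (q x) *\<^sub>R b = (\<Sum>b\<in>B. real_of_int (c b) *\<^sub>R b)"
        using M' by blast
      have "(\<Sum>b'\<in>B. real_of_int ((c(b := q x)) b') *\<^sub>R b') = (\<Sum>b\<in>B. real_of_int (c b) *\<^sub>R b)"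
        using \<open>b \<notin> B\<close> by (intro sum.cong) auto
      then have "x = (\<Sum>b'\<in>insert b B. real_of_int ((c(b := q x)) b') *\<^sub>R b')"
        using fin \<open>b \<notin> B\<close> c by (simp add: algebra_simps)
      then show "x \<in> {(\<Sum>b\<in>insert b B. real_of_int (c b) *\<^sub>R b) | c :: 'a \<Rightarrow> int. True}" by blast
    next
      fix x assume "x \<in> {(\<Sum>b\<in>insert b B. real_of_int (c b) *\<^sub>R b) | c :: 'a \<Rightarrow> int. True}"
      moreover have "insert b B \<subseteq> M" using \<open>B \<subseteq> M'\<close> b(1) by (auto simp: M'_def)
      ultimately show "x \<in> M"
        using subgroup_int_combination[of M "insert b B", OF zero diff] fin by blast
    qed
    moreover have "independent (insert b B)" using B b_span by (simp add: independent_insertI)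
    ultimately show ?thesis by blast
  qed
qed

text \<open>With \<open>S = Basis\<close> the support condition of the preceding lemma is vacuous;
  spanning passes from \<open>M\<close> to the basis found.\<close>

lemma euclidean_latticeI:
  fixes M :: "'a::euclidean_space set" and r :: real
  assumes "0 \<in> M" "\<And>x y. x \<in> M \<Longrightarrow> y \<in> M \<Longrightarrow> x - y \<in> M"
    and "r \<noteq> 0" "\<And>x b. x \<in> M \<Longrightarrow> b \<in> Basis \<Longrightarrow> r * (x \<bullet> b) \<in> \<int>"
    and "span M = UNIV"
  shows "euclidean_lattice M"
proof -
  obtain B where B: "independent B" "M = {(\<Sum>b\<in>B. real_of_int (c b) *\<^sub>R b) | c :: 'a \<Rightarrow> int. True}"
    using discrete_subgroup_has_basis[of Basis M r] assms by auto
  have "M \<subseteq> span B"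
    unfolding B(2) by (auto intro: span_sum span_scale span_base)
  then have "span B = UNIV"
    using assms(5) by (metis span_minimal subspace_span top.extremum_unique)
  with B show ?thesis unfolding euclidean_lattice_def by blast
qed

section \<open>Integer vectors and their inner product\<close>

definition int_dot :: "('n::finite \<Rightarrow> int) \<Rightarrow> ('n \<Rightarrow> int) \<Rightarrow> int" where
  "int_dot u v = (\<Sum>k\<in>UNIV. u k * v k)"

definition real_vec :: "('n::finite \<Rightarrow> int) \<Rightarrow> real ^ 'n" where
  "real_vec u = (\<chi> k. real_of_int (u k))"

lemma inner_real_vec: "real_vec u \<bullet> real_vec v = real_of_int (int_dot u v)"
  by (simp add: real_vec_def int_dot_def inner_vec_def)

lemma real_vec_diff: "real_vec u - real_vec v = real_vec (\<lambda>k. u k - v k)"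
  by (simp add: real_vec_def vec_eq_iff)

lemma real_vec_eq_0: "real_vec u = 0 \<longleftrightarrow> (\<forall>k. u k = 0)"
  by (simp add: real_vec_def vec_eq_iff)

lemma int_dot_commute: "int_dot u v = int_dot v u"
  by (simp add: int_dot_def mult.commute)

lemma int_dot_diff_left: "int_dot (\<lambda>k. u k - v k) w = int_dot u w - int_dot v w"
  by (simp add: int_dot_def sum_subtractf algebra_simps)

lemma int_dot_add_left: "int_dot (\<lambda>k. u k + v k) w = int_dot u w + int_dot v w"
  by (simp add: int_dot_def sum.distrib algebra_simps)

lemma int_dot_scale_left: "int_dot (\<lambda>k. a * u k) w = a * int_dot u w"
  by (simp add: int_dot_def sum_distrib_left algebra_simps)

lemma int_dot_sum_left: "int_dot (\<lambda>k. \<Sum>i<m. c i * g i k) w = (\<Sum>i<m. c i * int_dot (g i) w)"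
proof -
  have "int_dot (\<lambda>k. \<Sum>i<m. c i * g i k) w = (\<Sum>k\<in>UNIV. \<Sum>i<m. c i * (g i k * w k))"
    by (simp add: int_dot_def sum_distrib_right mult.assoc)
  also have "\<dots> = (\<Sum>i<m. \<Sum>k\<in>UNIV. c i * (g i k * w k))" by (rule sum.swap)
  finally show ?thesis by (simp add: int_dot_def sum_distrib_left)
qed

lemma int_dot_unit_left: "int_dot (\<lambda>k. if k = j then a else 0) w = a * w j"
  by (simp add: int_dot_def if_distrib[where f="\<lambda>x. x * _"] cong: if_cong)

text \<open>Every odd entry contributes at least 1 to the sum of squares. This turns weights of
  binary words into norm bounds.\<close>

lemma card_odd_le_int_dot: "int (card {k. odd (u k)}) \<le> int_dot u u"
proof -
  have "int (card {k. odd (u k)}) = (\<Sum>k\<in>UNIV. if odd (u k) then 1 else 0)"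
    by (simp add: sum.If_cases)
  also have "\<dots> \<le> (\<Sum>k\<in>UNIV. u k * u k)"
  proof (rule sum_mono)
    fix k
    have "u k \<noteq> 0 \<Longrightarrow> 0 < u k * u k" by (auto simp: zero_less_mult_iff)
    then show "(if odd (u k) then 1 else 0) \<le> u k * u k" by (cases "u k = 0") (auto)
  qed
  finally show ?thesis by (simp add: int_dot_def)
qed

lemma int_dot_self_pos:
  assumes "u k \<noteq> 0"
  shows "0 < int_dot u u"
  unfolding int_dot_def
  by (rule sum_pos2[where i=k]) (use assms in \<open>auto simp: zero_less_mult_iff\<close>)

section \<open>Construction A for quaternary codes\<close>

text \<open>
  The preimage in the integer vectors of the quaternary code whose residue code is spanned by the
  reductions of \<open>g 0, \<dots>, g (m - 1)\<close> modulo 2 and whose torsion code is the dual of the residue code.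
\<close>

definition quaternary_words :: "(nat \<Rightarrow> 'n::finite \<Rightarrow> int) \<Rightarrow> nat \<Rightarrow> ('n \<Rightarrow> int) set" where
  "quaternary_words g m =
    {\<lambda>k. (\<Sum>i<m. c i * g i k) + 2 * z k | c z. \<forall>i<m. even (int_dot z (g i))}"

text \<open>The factor is 1 / sqrt 4: inner products divisible by 4 become integers.\<close>

definition construction_A4 :: "(nat \<Rightarrow> 'n::finite \<Rightarrow> int) \<Rightarrow> nat \<Rightarrow> (real ^ 'n) set" where
  "construction_A4 g m = (\<lambda>y. (1/2) *\<^sub>R real_vec y) ` quaternary_words g m"

lemma quaternary_wordsI:
  assumes "\<And>k. y k = (\<Sum>i<m. c i * g i k) + 2 * z k" "\<And>i. i < m \<Longrightarrow> even (int_dot z (g i))"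
  shows "y \<in> quaternary_words g m"
  unfolding quaternary_words_def using assms by blast

lemma quaternary_words_double:
  assumes "\<And>i. i < m \<Longrightarrow> even (int_dot z (g i))"
  shows "(\<lambda>k. 2 * z k) \<in> quaternary_words g m"
  by (rule quaternary_wordsI[where c="\<lambda>_. 0" and z=z]) (use assms in auto)

text \<open>Halved, these words are twice the unit vectors. They make the lattice full-rank, force
  dual vectors to have half-integer coordinates, and attain norm 4.\<close>

lemma quaternary_words_unit: "(\<lambda>k. if k = j then 4 else 0) \<in> quaternary_words g m"
  by (rule quaternary_wordsI[where c="\<lambda>_. 0" and z="\<lambda>k. if k = j then 2 else 0"])
    (auto simp: int_dot_unit_left)

lemma quaternary_words_diff:
  assumes "x \<in> quaternary_words g m" "y \<in> quaternary_words g m"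
  shows "(\<lambda>k. x k - y k) \<in> quaternary_words g m"
proof -
  obtain c z where x: "x = (\<lambda>k. (\<Sum>i<m. c i * g i k) + 2 * z k)" "\<forall>i<m. even (int_dot z (g i))"
    using assms(1) unfolding quaternary_words_def by blast
  obtain d w where y: "y = (\<lambda>k. (\<Sum>i<m. d i * g i k) + 2 * w k)" "\<forall>i<m. even (int_dot w (g i))"
    using assms(2) unfolding quaternary_words_def by blast
  show ?thesis
    by (rule quaternary_wordsI[where c="\<lambda>i. c i - d i" and z="\<lambda>k. z k - w k"])
      (use x y in \<open>auto simp: algebra_simps sum_subtractf int_dot_diff_left\<close>)
qed

lemma lattice_construction_A4: "euclidean_lattice (construction_A4 g m)"
proof (rule euclidean_latticeI[where r=2])
  show "0 \<in> construction_A4 g m"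
    unfolding construction_A4_def
    \<comment> \<open>Zero is written as \<open>2 * 0\<close> to match the form in
      \<open>quaternary_words_double\<close>.\<close>
    by (rule image_eqI[where x="\<lambda>_. 2 * 0"])
      (simp add: real_vec_def vec_eq_iff, rule quaternary_words_double, simp add: int_dot_def)
  show "x - y \<in> construction_A4 g m"
    if "x \<in> construction_A4 g m" "y \<in> construction_A4 g m" for x y
  proof -
    from that obtain u v where uv: "u \<in> quaternary_words g m" "x = (1/2) *\<^sub>R real_vec u"
      "v \<in> quaternary_words g m" "y = (1/2) *\<^sub>R real_vec v"
      unfolding construction_A4_def by blast
    then show ?thesis
      unfolding construction_A4_def
      by (intro image_eqI[OF _ quaternary_words_diff[OF uv(1,3)]])
        (simp add: real_vec_diff[symmetric] scaleR_right_diff_distrib)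
  qed
  show "2 * (x \<bullet> b) \<in> \<int>" if "x \<in> construction_A4 g m" "b \<in> Basis" for x b
    using that by (auto simp: construction_A4_def Basis_vec_def inner_axis real_vec_def)
  have "b \<in> span (construction_A4 g m)" if b: "b \<in> Basis" for b :: "real ^ 'a"
  proof -
    obtain j where j: "b = axis j 1" using b unfolding Basis_vec_def by auto
    define v where "v = (1/2) *\<^sub>R real_vec (\<lambda>k. if k = j then 4 else 0)"
    have "b = (1/2) *\<^sub>R v"
      by (simp add: j v_def real_vec_def axis_def vec_eq_iff)
    moreover have "v \<in> construction_A4 g m"
      unfolding v_def construction_A4_def by (intro imageI quaternary_words_unit)
    ultimately show ?thesis by (simp add: span_scale span_base)
  qed
  then have "span Basis \<subseteq> span (construction_A4 g m)"
    by (intro span_minimal subspace_span subsetI)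
  then show "span (construction_A4 g m) = UNIV"
    unfolding span_Basis by blast
qed simp

text \<open>Modulo 4 the products of rows vanish by \<open>gram\<close>, the mixed terms are twice
  an even number, and the product of the two doubled parts is a multiple of 4.\<close>

lemma quaternary_words_self_orthogonal:
  assumes gram: "\<And>i j. i < m \<Longrightarrow> j < m \<Longrightarrow> 4 dvd int_dot (g i) (g j)"
    and "x \<in> quaternary_words g m" "y \<in> quaternary_words g m"
  shows "4 dvd int_dot x y"
proof -
  obtain c z where x: "x = (\<lambda>k. (\<Sum>i<m. c i * g i k) + 2 * z k)" "\<forall>i<m. even (int_dot z (g i))"
    using assms(2) unfolding quaternary_words_def by blast
  obtain d w where y: "y = (\<lambda>k. (\<Sum>i<m. d i * g i k) + 2 * w k)" "\<forall>i<m. even (int_dot w (g i))"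
    using assms(3) unfolding quaternary_words_def by blast
  have "4 dvd int_dot (g i) y" if "i < m" for i
  proof -
    have "4 dvd (\<Sum>j<m. d j * int_dot (g j) (g i))"
      using gram that by (intro dvd_sum dvd_mult) auto
    moreover have "even (int_dot w (g i))" using y(2) that by blast
    then have "4 dvd 2 * int_dot w (g i)" by presburger
    ultimately have "4 dvd int_dot y (g i)"
      unfolding y(1) int_dot_add_left int_dot_sum_left int_dot_scale_left by (rule dvd_add)
    then show ?thesis by (simp add: int_dot_commute)
  qed
  then have 1: "4 dvd (\<Sum>i<m. c i * int_dot (g i) y)"
    by (intro dvd_sum dvd_mult) auto
  have "even (\<Sum>i<m. d i * int_dot (g i) z)"
    using x(2) by (intro dvd_sum dvd_mult) (auto simp: int_dot_commute)
  then have "even (int_dot y z)"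
    by (simp add: y(1) int_dot_add_left int_dot_sum_left int_dot_scale_left)
  then have "4 dvd 2 * int_dot z y" unfolding int_dot_commute[of z] by presburger
  with 1 show ?thesis
    unfolding x(1) int_dot_add_left int_dot_sum_left int_dot_scale_left by (rule dvd_add)
qed

text \<open>By \<open>pivot\<close> the rows are systematic modulo 2. Subtracting the combination
  read off at the pivots leaves a vector \<open>u\<close>; testing \<open>y\<close> against doubled
  dual words shows that \<open>u\<close> is even, and testing it against the rows shows that half of
  \<open>u\<close> is a dual word modulo 2.\<close>

lemma quaternary_words_self_dual:
  fixes g :: "nat \<Rightarrow> 'n::finite \<Rightarrow> int"
  assumes pivot: "\<And>i j. i < m \<Longrightarrow> j < m \<Longrightarrow> odd (g i (p j)) \<longleftrightarrow> i = j"
    and y: "\<And>x. x \<in> quaternary_words g m \<Longrightarrow> 4 dvd int_dot y x"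
    and gram: "\<And>i j. i < m \<Longrightarrow> j < m \<Longrightarrow> 4 dvd int_dot (g i) (g j)"
  shows "y \<in> quaternary_words g m"
proof -
  define u where "u = (\<lambda>k. y k - (\<Sum>i<m. y (p i) * g i k))"
  have even_u: "even (u k)" for k
  proof (cases "k \<in> p ` {..<m}")
    case True
    then obtain j where j: "j < m" "k = p j" by auto
    \<comment> \<open>At the pivot of row \<open>j\<close> only that row is odd, so the sum has the
      parity of \<open>y (p j)\<close>.\<close>
    have "(\<Sum>i<m. y (p i) * g i (p j)) =
      y (p j) * g j (p j) + (\<Sum>i\<in>{..<m} - {j}. y (p i) * g i (p j))"
      using j by (simp add: sum.remove)
    moreover have "even (\<Sum>i\<in>{..<m} - {j}. y (p i) * g i (p j))"
      using pivot j by (intro dvd_sum dvd_mult) auto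
    moreover have "odd (g j (p j))" using pivot j by auto
    ultimately show ?thesis by (auto simp: u_def j)
  next
    case False
    \<comment> \<open>This is the dual word modulo 2 attached to the non-pivot coordinate
      \<open>k\<close>: a 1 at \<open>k\<close>, with column \<open>k\<close> of the rows copied to
      the pivots.\<close>
    define z where "z = (\<lambda>l. (if l = k then 1 else 0) + (\<Sum>i<m. if l = p i then g i k else 0))"
    have z_dot: "int_dot z w = w k + (\<Sum>i<m. g i k * w (p i))" for w
    proof -
      have "int_dot (\<lambda>l. \<Sum>i<m. if l = p i then g i k else 0) w =
        (\<Sum>l\<in>UNIV. \<Sum>i<m. if l = p i then g i k * w l else 0)"
        unfolding int_dot_def sum_distrib_right by (intro sum.cong refl) simp
      also have "\<dots> = (\<Sum>i<m. \<Sum>l\<in>UNIV. if l = p i then g i k * w l else 0)"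
        by (rule sum.swap)
      finally show ?thesis by (simp add: z_def int_dot_add_left int_dot_unit_left)
    qed
    have "even (int_dot z (g i))" if "i < m" for i
    proof -
      have "(\<Sum>j<m. g j k * g i (p j)) =
        g i k * g i (p i) + (\<Sum>j\<in>{..<m} - {i}. g j k * g i (p j))"
        using that by (simp add: sum.remove)
      moreover have "even (\<Sum>j\<in>{..<m} - {i}. g j k * g i (p j))"
        using pivot that by (intro dvd_sum dvd_mult) auto
      moreover have "odd (g i (p i))" using pivot that by auto
      ultimately show ?thesis by (auto simp: z_dot)
    qed
    then have "4 dvd int_dot y (\<lambda>l. 2 * z l)"
      by (intro y quaternary_words_double)
    then have "4 dvd 2 * int_dot z y"
      by (simp add: int_dot_commute[of y] int_dot_scale_left)
    then have "even (int_dot z y)" by presburger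
    \<comment> \<open>The sum over pivots enters with opposite signs in \<open>u k\<close> and in
      the product, which is an even difference.\<close>
    moreover have "int_dot z y = u k + 2 * (\<Sum>i<m. y (p i) * g i k)"
      by (simp add: z_dot u_def mult.commute)
    ultimately show ?thesis by simp
  qed
  define z where "z k = u k div 2" for k
  have z: "2 * z k = u k" for k using even_u by (simp add: z_def)
  show ?thesis
  proof (rule quaternary_wordsI[where c="\<lambda>i. y (p i)" and z=z])
    show "y k = (\<Sum>i<m. y (p i) * g i k) + 2 * z k" for k by (simp add: z u_def)
    fix j assume j: "j < m"
    have "g j \<in> quaternary_words g m"
      by (rule quaternary_wordsI[where c="\<lambda>i. if i = j then 1 else 0" and z="\<lambda>_. 0"])
        (use j in \<open>auto simp: int_dot_def if_distrib[where f="\<lambda>x. x * _"] cong: if_cong\<close>)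
    then have "4 dvd int_dot y (g j)" by (rule y)
    moreover have "4 dvd (\<Sum>i<m. y (p i) * int_dot (g i) (g j))"
      using gram j by (intro dvd_sum dvd_mult) auto
    ultimately have "4 dvd int_dot u (g j)"
      unfolding u_def int_dot_diff_left int_dot_sum_left by (rule dvd_diff)
    moreover have "u = (\<lambda>k. 2 * z k)" by (simp add: z)
    then have "int_dot u (g j) = 2 * int_dot z (g j)" by (simp only: int_dot_scale_left)
    ultimately show "even (int_dot z (g j))" by presburger
  qed
qed

section \<open>Unimodularity, minimum norm and parity of the lattice\<close>

lemma unimodular_construction_A4:
  fixes g :: "nat \<Rightarrow> 'n::finite \<Rightarrow> int"
  assumes pivot: "\<And>i j. i < m \<Longrightarrow> j < m \<Longrightarrow> odd (g i (p j)) \<longleftrightarrow> i = j"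
    and gram: "\<And>i j. i < m \<Longrightarrow> j < m \<Longrightarrow> 4 dvd int_dot (g i) (g j)"
  shows "unimodular_lattice (construction_A4 g m)"
proof -
  let ?L = "construction_A4 g m"
  have "x \<bullet> y \<in> \<int>" if "x \<in> ?L" "y \<in> ?L" for x y
  proof -
    from that obtain u v where uv: "u \<in> quaternary_words g m" "x = (1/2) *\<^sub>R real_vec u"
      "v \<in> quaternary_words g m" "y = (1/2) *\<^sub>R real_vec v"
      unfolding construction_A4_def by blast
    have "4 dvd int_dot u v"
      by (rule quaternary_words_self_orthogonal[OF _ uv(1,3)]) (rule gram)
    then obtain t where "int_dot u v = 4 * t" by (elim dvdE)
    then show ?thesis using uv by (simp add: inner_real_vec)
  qed
  moreover have "x \<in> ?L" if x: "\<And>y. y \<in> ?L \<Longrightarrow> x \<bullet> y \<in> \<int>" for x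
  proof -
    \<comment> \<open>Testing \<open>x\<close> against twice the \<open>k\<close>-th unit vector
      shows that \<open>x\<close> is half of an integer vector, so self-duality of the code
      applies.\<close>
    have ints: "2 * (x $ k) \<in> \<int>" for k
    proof -
      have "x \<bullet> ((1/2) *\<^sub>R real_vec (\<lambda>l. if l = k then 4 else 0)) \<in> \<int>"
        by (rule x) (simp add: construction_A4_def quaternary_words_unit)
      moreover have "real_vec (\<lambda>l. if l = k then 4 else 0) = axis k 4"
        by (simp add: real_vec_def axis_def vec_eq_iff)
      ultimately show ?thesis by (simp add: inner_axis mult.commute)
    qed
    define y where "y k = \<lfloor>2 * (x $ k)\<rfloor>" for k
    have y: "real_of_int (y k) = 2 * (x $ k)" for k
      using ints[of k] unfolding y_def by (metis Ints_cases floor_of_int)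
    have x_eq: "x = (1/2) *\<^sub>R real_vec y"
      by (simp add: vec_eq_iff real_vec_def y)
    have "y \<in> quaternary_words g m"
    proof (rule quaternary_words_self_dual[where p=p])
      fix v assume "v \<in> quaternary_words g m"
      then have "x \<bullet> ((1/2) *\<^sub>R real_vec v) \<in> \<int>"
        by (intro x) (simp add: construction_A4_def)
      then obtain t where "x \<bullet> ((1/2) *\<^sub>R real_vec v) = real_of_int t"
        by (elim Ints_cases)
      then have "real_of_int (int_dot y v) = real_of_int (4 * t)"
        by (simp add: x_eq inner_real_vec)
      then have "int_dot y v = 4 * t" by (simp only: of_int_eq_iff)
      then show "4 dvd int_dot y v" by simp
    qed (use pivot gram in auto)
    then show ?thesis by (simp add: x_eq construction_A4_def)
  qed
  ultimately show ?thesis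
    using lattice_construction_A4[of g m]
    unfolding unimodular_lattice_def dual_lattice_def by blast
qed

text \<open>The bound 16 is norm 4 before halving. \<open>weight\<close> encodes minimum weight 16
  together with independence of the rows modulo 2; \<open>dual\<close> says that no nonempty set of
  at most 3 coordinates supports a dual word.\<close>

lemma quaternary_words_norm:
  fixes g :: "nat \<Rightarrow> 'n::finite \<Rightarrow> int"
  assumes gram: "\<And>i j. i < m \<Longrightarrow> j < m \<Longrightarrow> 4 dvd int_dot (g i) (g j)"
    and weight: "\<And>c. \<exists>i<m. odd (c i) \<Longrightarrow> 16 \<le> card {k. odd (\<Sum>i<m. c i * g i k)}"
    and dual: "\<And>S. S \<noteq> {} \<Longrightarrow> card S \<le> 3 \<Longrightarrow> \<exists>i<m. odd (\<Sum>k\<in>S. g i k)"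
    and y: "y \<in> quaternary_words g m" "y l \<noteq> 0"
  shows "16 \<le> int_dot y y"
proof -
  obtain c z where cz: "y = (\<lambda>k. (\<Sum>i<m. c i * g i k) + 2 * z k)" "\<forall>i<m. even (int_dot z (g i))"
    using y(1) unfolding quaternary_words_def by blast
  show ?thesis
  proof (cases "\<exists>i<m. odd (c i)")
    case True
    then show ?thesis
      using weight[of c] card_odd_le_int_dot[of y] by (simp add: cz(1))
  next
    case False
    \<comment> \<open>All coefficients are even, so \<open>y\<close> is twice \<open>w\<close>. This
      \<open>w\<close> still reduces to a dual word, because products of rows are even.\<close>
    define w where "w = (\<lambda>k. (\<Sum>i<m. (c i div 2) * g i k) + z k)"
    have y_w: "y = (\<lambda>k. 2 * w k)"
    proof
      fix k
      have "(\<Sum>i<m. c i * g i k) = (\<Sum>i<m. 2 * (c i div 2 * g i k))"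
        using False by (intro sum.cong) (auto simp: mult.assoc[symmetric])
      then show "y k = 2 * w k" by (simp add: cz(1) w_def sum_distrib_left)
    qed
    have w_orth: "even (int_dot w (g j))" if "j < m" for j
    proof -
      have "4 dvd (\<Sum>i<m. (c i div 2) * int_dot (g i) (g j))"
        using gram that by (intro dvd_sum dvd_mult) auto
      then have "even (\<Sum>i<m. (c i div 2) * int_dot (g i) (g j))" by presburger
      then show ?thesis
        using cz(2) that by (simp add: w_def int_dot_add_left int_dot_sum_left)
    qed
    define S where "S = {k. odd (w k)}"
    have "4 \<le> int_dot w w"
    proof (cases "S = {}")
      case True
      define v where "v k = w k div 2" for k
      have v: "w = (\<lambda>k. 2 * v k)" using True by (auto simp: S_def v_def)
      have "v l \<noteq> 0" using y(2) by (simp add: y_w v)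
      then have "0 < int_dot v v" by (rule int_dot_self_pos)
      moreover have "int_dot w w = 4 * int_dot v v"
        unfolding v by (simp add: int_dot_def sum_distrib_left)
      ultimately show ?thesis by simp
    next
      case False
      have "\<not> card S \<le> 3"
      proof
        assume "card S \<le> 3"
        then obtain i where i: "i < m" "odd (\<Sum>k\<in>S. g i k)" using dual False by blast
        have "int_dot w (g i) = (\<Sum>k\<in>S. w k * g i k) + (\<Sum>k\<in>-S. w k * g i k)"
          unfolding int_dot_def by (subst sum.subset_diff[of S]) (auto simp: Compl_eq_Diff_UNIV)
        moreover have "even (\<Sum>k\<in>-S. w k * g i k)"
          by (intro dvd_sum) (auto simp: S_def)
        ultimately have "even (\<Sum>k\<in>S. w k * g i k)" using w_orth[OF i(1)] by simp
        \<comment> \<open>Replacing the odd values \<open>w k\<close> on \<open>S\<close> by 1 keeps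
          the parity, so \<open>S\<close> itself would be the support of a dual word.\<close>
        moreover have "even (\<Sum>k\<in>S. (w k - 1) * g i k)"
          by (intro dvd_sum) (auto simp: S_def)
        ultimately show False
          using i(2) by (simp add: left_diff_distrib sum_subtractf)
      qed
      then show ?thesis using card_odd_le_int_dot[of w] by (simp add: S_def)
    qed
    moreover have "int_dot y y = 4 * int_dot w w"
      unfolding y_w by (simp add: int_dot_def sum_distrib_left)
    ultimately show ?thesis by simp
  qed
qed

lemma minimum_norm_construction_A4:
  fixes g :: "nat \<Rightarrow> 'n::finite \<Rightarrow> int"
  assumes "\<And>i j. i < m \<Longrightarrow> j < m \<Longrightarrow> 4 dvd int_dot (g i) (g j)"
    and "\<And>c. \<exists>i<m. odd (c i) \<Longrightarrow> 16 \<le> card {k. odd (\<Sum>i<m. c i * g i k)}"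
    and "\<And>S. S \<noteq> {} \<Longrightarrow> card S \<le> 3 \<Longrightarrow> \<exists>i<m. odd (\<Sum>k\<in>S. g i k)"
  shows "has_minimum_norm (construction_A4 g m) 4"
  unfolding has_minimum_norm_def
proof (intro conjI ballI impI)
  \<comment> \<open>Any coordinate serves: twice its unit vector has norm 4.\<close>
  define j :: 'n where "j = undefined"
  define y :: "'n \<Rightarrow> int" where "y = (\<lambda>k. if k = j then 4 else 0)"
  have "(1/2) *\<^sub>R real_vec y \<in> construction_A4 g m"
    unfolding y_def construction_A4_def by (intro imageI quaternary_words_unit)
  moreover have "int_dot y y = 16"
    unfolding y_def int_dot_unit_left by simp
  ultimately show "\<exists>x\<in>construction_A4 g m. x \<noteq> 0 \<and> x \<bullet> x = 4"
    by (intro bexI[of _ "(1/2) *\<^sub>R real_vec y"]) (auto simp: inner_real_vec real_vec_eq_0 y_def)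
next
  fix x assume "x \<in> construction_A4 g m" "x \<noteq> 0"
  then obtain y l where y: "y \<in> quaternary_words g m" "x = (1/2) *\<^sub>R real_vec y" "y l \<noteq> 0"
    unfolding construction_A4_def by (auto simp: real_vec_eq_0)
  have "16 \<le> int_dot y y"
    by (rule quaternary_words_norm[OF assms y(1,3)])
  then show "4 \<le> x \<bullet> x" by (simp add: y(2) inner_real_vec)
qed

text \<open>A lift \<open>z\<close> of a dual word is itself a lattice vector, being half of its
  double.\<close>

lemma odd_construction_A4:
  assumes "unimodular_lattice (construction_A4 g m)"
    and "\<And>i. i < m \<Longrightarrow> even (int_dot z (g i))" "odd (int_dot z z)"
  shows "odd_unimodular_lattice (construction_A4 g m)"
proof -
  have "(1/2) *\<^sub>R real_vec (\<lambda>k. 2 * z k) \<in> construction_A4 g m"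
    unfolding construction_A4_def using assms(2) by (intro imageI quaternary_words_double)
  moreover have "(1/2) *\<^sub>R real_vec (\<lambda>k. 2 * z k) = real_vec z"
    by (simp add: real_vec_def vec_eq_iff)
  ultimately have "real_vec z \<in> construction_A4 g m" by simp
  moreover have "\<not> (\<exists>k. even k \<and> real_vec z \<bullet> real_vec z = real_of_int k)"
    using assms(3) by (auto simp: inner_real_vec)
  ultimately show ?thesis
    using assms(1) unfolding odd_unimodular_lattice_def even_unimodular_lattice_def by blast
qed

section \<open>The explicit binary code and its verification by evaluation\<close>

text \<open>
  Modulo 2 the rows are a systematic generator matrix of a doubly-even [41,9,16] code with dual
  distance 4, found by a random search among codes invariant under a permutation of the coordinates
  with eight 5-cycles and one fixed point. The entries 2 left of the diagonal lift it so that all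
  inner products of rows become divisible by 4.
\<close>

definition code_rows :: "int list list" where
  "code_rows =
   [[1,0,0,0,0,0,0,0,0,0,0,0,1,0,1,0,1,0,1,1,0,1,1,0,0,0,0,0,1,1,1,1,1,0,0,0,0,1,0,1,1],
    [2,1,0,0,0,0,0,0,0,0,1,0,0,1,0,1,0,1,0,1,0,0,1,1,0,1,0,0,0,1,0,1,1,1,0,1,0,0,1,0,1],
    [2,2,1,0,0,0,0,0,0,0,0,1,0,0,1,1,1,0,1,0,0,0,0,1,1,1,1,0,0,0,0,0,1,1,1,0,1,0,0,1,1],
    [2,2,2,1,0,0,0,0,0,0,1,0,1,0,0,0,1,1,0,1,1,0,0,0,1,0,1,1,0,0,1,0,0,1,1,1,0,1,0,0,1],
    [2,2,2,2,1,0,0,0,0,0,0,1,0,1,0,1,0,1,1,0,1,1,0,0,0,0,0,1,1,0,1,1,0,0,1,0,1,0,1,0,1],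
    [2,2,0,2,2,1,0,0,0,1,1,0,1,1,1,0,0,1,1,0,0,1,0,0,1,1,0,1,0,0,0,0,1,1,0,0,1,0,0,1,0],
    [0,2,0,2,0,2,1,0,0,1,0,1,1,0,0,0,0,1,0,1,1,1,1,0,1,1,1,1,1,0,0,0,1,0,1,1,1,1,0,1,0],
    [0,2,0,0,2,0,0,1,0,1,1,0,0,0,1,1,0,1,0,0,1,0,1,1,1,1,1,0,1,1,1,0,1,0,0,1,0,1,1,1,0],
    [2,0,2,2,2,2,0,2,1,1,0,1,1,1,1,0,1,1,0,0,1,0,0,1,0,0,1,0,0,1,0,1,1,0,0,1,0,0,1,0,0]]"

text \<open>On \<open>bool\<close>, \<open>\<noteq>\<close> is addition modulo 2. Listing all sums
  of rows lets the weight check run over 512 words.\<close>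

fun binary_span :: "nat \<Rightarrow> bool list list \<Rightarrow> bool list list" where
  "binary_span n [] = [replicate n False]"
| "binary_span n (r # rs) = (let W = binary_span n rs in W @ map (map2 (\<noteq>) r) W)"

lemma code_rows_gram:
  "\<forall>r\<in>set code_rows. \<forall>s\<in>set code_rows. (\<Sum>k\<leftarrow>[0..<41]. r ! k * s ! k) mod 4 = 0"
  by code_simp

lemma code_rows_weight:
  "\<forall>w\<in>set (binary_span 41 (map (map odd) code_rows)). w = replicate 41 False \<or> 16 \<le> length (filter id w)"
  by code_simp

text \<open>Dual distance at least 4, stated by columns: a dual word of weight 2 would be two equal
  columns, one of weight 3 two columns adding up to a third. The case \<open>x = y\<close> says that
  the zero word is not a column, which excludes weight 1.\<close>

lemma code_rows_columns:
  "let C = map (\<lambda>k. map (\<lambda>r. odd (r ! k)) code_rows) [0..<41] in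
    distinct C \<and> (\<forall>x\<in>set C. \<forall>y\<in>set C. map2 (\<noteq>) x y \<notin> set C)"
  by code_simp

lemma length_code_rows: "length code_rows = 9"
  by (simp add: code_rows_def)

lemma code_rows_pivot: "\<forall>i\<in>{..<9}. \<forall>j\<in>{..<9}. odd (code_rows ! i ! j) \<longleftrightarrow> i = j"
  by code_simp

text \<open>These five coordinates support a dual word of odd weight, the source of a vector of odd
  norm.\<close>

lemma code_rows_odd_dual:
  "\<forall>r\<in>set code_rows. even (\<Sum>j\<in>{5,6,7,8,9}. r ! j)"
  by code_simp

text \<open>The parity pattern of an integer combination depends only on the parities of the
  coefficients: the first row is added exactly when its coefficient is odd.\<close>

lemma map_odd_combination_in_binary_span:
  assumes "\<forall>r\<in>set rs. length r = n"
  shows "map (\<lambda>k. odd (\<Sum>i<length rs. c i * rs ! i ! k)) [0..<n] \<in> set (binary_span n (map (map odd) rs))"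
  using assms
proof (induction rs arbitrary: c)
  case Nil
  then show ?case by (simp add: map_replicate_const)
next
  case (Cons r rs)
  define w where "w = map (\<lambda>k. odd (\<Sum>i<length rs. c (Suc i) * rs ! i ! k)) [0..<n]"
  have w: "w \<in> set (binary_span n (map (map odd) rs))"
    unfolding w_def using Cons.IH[of "\<lambda>i. c (Suc i)"] Cons.prems by simp
  have sum: "(\<Sum>i<length (r # rs). c i * (r # rs) ! i ! k) =
    c 0 * r ! k + (\<Sum>i<length rs. c (Suc i) * rs ! i ! k)" for k
    by (simp add: sum.lessThan_Suc_shift del: sum.lessThan_Suc)
  have "map (\<lambda>k. odd (\<Sum>i<length (r # rs). c i * (r # rs) ! i ! k)) [0..<n] =
    (if odd (c 0) then map2 (\<noteq>) (map odd r) w else w)"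
    using Cons.prems unfolding sum by (intro nth_equalityI) (auto simp: w_def)
  then show ?case using w by (auto simp: Let_def)
qed

section \<open>Transfer of the code to coordinates indexed by the type \<open>41\<close>\<close>

theorem proposition2:
  shows "\<exists>L :: (real ^ 41) set. odd_unimodular_lattice L \<and> has_minimum_norm L 4"
proof -
  \<comment> \<open>The numbering \<open>e\<close> links the coordinates of the vector space to list
    positions; any bijection works.\<close>
  obtain e :: "41 \<Rightarrow> nat" where e: "bij_betw e (UNIV :: 41 set) {..<41}"
    using ex_bij_betw_finite_nat[of "UNIV :: 41 set"] by (auto simp: atLeast0LessThan)
  then have e_inj: "inj e" and e_less: "e k < 41" for k
    by (auto simp: bij_betw_def)
  have e_inv: "e (inv e j) = j" if "j < 41" for j
    using e that by (auto simp: bij_betw_def intro: f_inv_into_f)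
  define g where "g i k = code_rows ! i ! (e k)" for i k
  have rows: "code_rows ! i \<in> set code_rows" if "i < 9" for i
    using that by (simp add: length_code_rows)
  have gram: "4 dvd int_dot (g i) (g j)" if "i < 9" "j < 9" for i j
    using code_rows_gram rows[OF that(1)] rows[OF that(2)]
      sum.reindex_bij_betw[OF e, of "\<lambda>k. code_rows ! i ! k * code_rows ! j ! k"]
    by (simp add: int_dot_def g_def sum_list_distinct_conv_sum_set atLeast0LessThan dvd_eq_mod_eq_0)
  have pivot: "odd (g i (inv e j)) \<longleftrightarrow> i = j" if "i < 9" "j < 9" for i j
    using code_rows_pivot that by (simp add: g_def e_inv)
  have weight: "16 \<le> card {k. odd (\<Sum>i<9. c i * g i k)}" if c: "\<exists>i<9. odd (c i)" for c
  proof -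
    define w where "w = map (\<lambda>k. odd (\<Sum>i<9. c i * code_rows ! i ! k)) [0..<41]"
    have "w \<in> set (binary_span 41 (map (map odd) code_rows))"
      unfolding w_def length_code_rows[symmetric]
      by (rule map_odd_combination_in_binary_span) (simp add: code_rows_def)
    moreover have "w \<noteq> replicate 41 False"
    proof
      obtain j where j: "j < 9" "odd (c j)" using c by blast
      assume "w = replicate 41 False"
      then have "\<not> w ! j" using j by simp
      \<comment> \<open>For \<open>c j\<close> odd, the combination is odd at pivot
        \<open>j\<close>, so its word is nonzero.\<close>
      moreover have "(\<Sum>i<9. c i * code_rows ! i ! j) =
        c j * code_rows ! j ! j + (\<Sum>i\<in>{..<9} - {j}. c i * code_rows ! i ! j)"
        using j by (simp add: sum.remove)
      moreover have "even (\<Sum>i\<in>{..<9} - {j}. c i * code_rows ! i ! j)"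
        using code_rows_pivot j by (intro dvd_sum dvd_mult) auto
      moreover have "odd (code_rows ! j ! j)" using code_rows_pivot j by blast
      ultimately show False using j by (simp add: w_def)
    qed
    ultimately have "16 \<le> length (filter id w)" using code_rows_weight by blast
    also have "length (filter id w) = card {k. k < 41 \<and> w ! k}"
      by (simp add: length_filter_conv_card w_def)
    also have "{k. k < 41 \<and> w ! k} = e ` {k. odd (\<Sum>i<9. c i * g i k)}"
    proof (intro equalityI subsetI)
      fix j assume "j \<in> {k. k < 41 \<and> w ! k}"
      then show "j \<in> e ` {k. odd (\<Sum>i<9. c i * g i k)}"
        by (intro image_eqI[where x = "inv e j"]) (auto simp: w_def g_def e_inv)
    qed (auto simp: w_def g_def e_less)
    also have "card \<dots> = card {k. odd (\<Sum>i<9. c i * g i k)}"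
      using e_inj by (intro card_image) (auto intro: inj_on_subset)
    finally show ?thesis .
  qed
  have dual: "\<exists>i<9. odd (\<Sum>k\<in>S. g i k)" if S: "S \<noteq> {}" "card S \<le> 3" for S
  proof (rule ccontr)
    assume neg: "\<not> ?thesis"
    have even: "even (\<Sum>k\<in>S. code_rows ! i ! e k)" if "i < 9" for i
      using neg that by (auto simp: g_def)
    define col where "col j = map (\<lambda>r. odd (r ! j)) code_rows" for j
    define C where "C = map col [0..<41]"
    have C: "distinct C" "\<And>x y. x \<in> set C \<Longrightarrow> y \<in> set C \<Longrightarrow> map2 (\<noteq>) x y \<notin> set C"
      using code_rows_columns unfolding C_def col_def Let_def by blast+
    have col_C: "col (e k) \<in> set C" for k using e_less by (simp add: C_def)
    have col_inj: "col (e k) = col (e l) \<Longrightarrow> k = l" for k l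
      using C(1) e_less e_inj by (auto simp: C_def distinct_map inj_on_def inj_def)
    have col_nth: "length (col j) = 9" "i < 9 \<Longrightarrow> col j ! i = odd (code_rows ! i ! j)" for i j
      by (simp_all add: col_def length_code_rows)
    have "0 < card S" using S(1) by (simp add: card_gt_0_iff)
    then have "card S = 1 \<or> card S = 2 \<or> card S = 3" using S(2) by linarith
    then consider a where "S = {a}" | a b where "S = {a, b}" "a \<noteq> b"
      | a b c where "S = {a, b, c}" "a \<noteq> b" "a \<noteq> c" "b \<noteq> c"
      unfolding One_nat_def card_1_singleton_iff card_2_iff card_3_iff by blast
    then show False
    proof cases
      case 1
      \<comment> \<open>The column is zero, hence equal to its sum with itself.\<close>
      have "map2 (\<noteq>) (col (e a)) (col (e a)) = col (e a)"
        using even by (intro nth_equalityI) (auto simp: col_nth 1)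
      then show False using C(2)[OF col_C[of a] col_C[of a]] col_C[of a] by simp
    next
      case 2
      have "col (e a) = col (e b)"
        using even by (intro nth_equalityI) (auto simp: col_nth 2)
      then show False using col_inj 2 by blast
    next
      case 3
      have "map2 (\<noteq>) (col (e a)) (col (e b)) = col (e c)"
        using even by (intro nth_equalityI) (auto simp: col_nth 3)
      then show False using C(2)[OF col_C[of a] col_C[of b]] col_C[of c] by simp
    qed
  qed
  have unimodular: "unimodular_lattice (construction_A4 g 9)"
    by (rule unimodular_construction_A4[where p = "inv e"]) (use pivot gram in auto)
  define z where "z k = (if e k \<in> {5,6,7,8,9} then 1 else 0 :: int)" for k
  have z_dot: "int_dot z (\<lambda>k. h (e k)) = (\<Sum>j\<in>{5,6,7,8,9}. h j)" for h
  proof -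
    have "int_dot z (\<lambda>k. h (e k)) = (\<Sum>j<41. if j \<in> {5,6,7,8,9} then h j else 0)"
      unfolding int_dot_def z_def sum.reindex_bij_betw[OF e, symmetric] by (intro sum.cong) auto
    also have "\<dots> = (\<Sum>j\<in>{..<41} \<inter> {5,6,7,8,9}. h j)"
      by (rule sum.inter_restrict[symmetric]) simp
    also have "{..<41} \<inter> {5,6,7,8,9} = {5,6,7,8,9::nat}" by auto
    finally show ?thesis .
  qed
  have "odd_unimodular_lattice (construction_A4 g 9)"
  proof (rule odd_construction_A4[where z = z, OF unimodular])
    show "even (int_dot z (g i))" if "i < 9" for i
      using code_rows_odd_dual rows[OF that] z_dot[of "\<lambda>j. code_rows ! i ! j"]
      by (simp only: g_def[abs_def])
    \<comment> \<open>The product counts the support of \<open>z\<close>, which has five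
      elements.\<close>
    show "odd (int_dot z z)"
      using z_dot[of "\<lambda>j. if j \<in> {5,6,7,8,9} then 1 else 0"] by (simp add: z_def[abs_def])
  qed
  moreover have "has_minimum_norm (construction_A4 g 9) 4"
    by (rule minimum_norm_construction_A4) (use gram weight dual in auto)
  ultimately show ?thesis by blast
qed

end
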